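(* Let $n_y \ge 1$ be an integer, $Y=\{1,\dots,n_y\}$, and let $r', r''$ be real numbers such that $m = r'-r''$ satisfies $1 \le m \le n_y$. Let $\rho(\mathbf b) = -H(\mathbf b)$ be the negative Shannon entropy and let $\rho'(\mathbf b) = \max_{j\in Y}\left(\langle \mathbf b,\mathbf r_j\rangle - \rho^*(\mathbf r_j)\right)$, where $\mathbf r_j\in\mathbb R^{n_y}$ is the vector whose $j$-th entry is $r'$ and all of whose other entries are $r''$. Then for every $\mathbf b\in[0,1]^{n_y}$ with $\sum_{i\in Y} b_i = 1$, $$\rho(\mathbf b)-\rho'(\mathbf b) \le \max\{\epsilon_1,\epsilon_2\} - r'' + \log\left(e^{r'} + (n_y-1)e^{r''}\right),$$ where $$\epsilon_1 = \log\left(\tfrac{1}{r'-r''}\right) - 1, \qquad \epsilon_2 = \log\left(\tfrac{1}{n_y}\right) - \frac{r'-r''}{n_y}.$$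
   Context: $\log$ is the natural logarithm. For a probability vector $\mathbf b=(b_1,\dots,b_{n_y})$ (nonnegative entries summing to $1$), the Shannon entropy is $H(\mathbf b) = -\sum_{i\in Y} b_i\log b_i$, with the convention $0\log 0=0$. The Fenchel conjugate $\rho^*$ of $\rho=-H$, whose domain is the set of probability vectors, is $\rho^*(\mathbf x)=\sup_{\mathbf b}\left(\langle \mathbf b,\mathbf x\rangle-\rho(\mathbf b)\right)$, the supremum being over all probability vectors $\mathbf b$; it equals $\log\left(\sum_{i\in Y} e^{x_i}\right)$. The vectors $\mathbf r_j$ encode the prediction reward that gives $r'$ when the prediction $j$ equals the true value $i \in Y$ and $r''$ otherwise. *)

theory Defs
  imports "HOL-Analysis.Analysis"
begin

definition prob_vectors :: "(real ^ 'n) set" where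
  "prob_vectors = {b. (\<forall>i. 0 \<le> b $ i) \<and> (\<Sum>i\<in>UNIV. b $ i) = 1}"

(* The convention 0 log 0 = 0 holds because a product with 0 is 0, whatever the value of ln 0. *)
definition shannon_entropy :: "real ^ 'n \<Rightarrow> real" where
  "shannon_entropy b = - (\<Sum>i\<in>UNIV. b $ i * ln (b $ i))"

definition neg_entropy :: "real ^ 'n \<Rightarrow> real" where
  "neg_entropy b = - shannon_entropy b"

(* Fenchel conjugate of a function f with effective domain D (f is taken to be infinite outside D).
   The supremum is the real one, so it is meaningful only where the values b \<bullet> x - f b are
   bounded above on D; for D = prob_vectors and f = neg_entropy this is the case at every x. *)
definition fenchel_conjugate ::
  "(real ^ 'n) set \<Rightarrow> (real ^ 'n \<Rightarrow> real) \<Rightarrow> real ^ 'n \<Rightarrow> real" where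
  "fenchel_conjugate D f x = (SUP b\<in>D. b \<bullet> x - f b)"

definition prediction_reward :: "real \<Rightarrow> real \<Rightarrow> 'n \<Rightarrow> real ^ 'n" where
  "prediction_reward r' r'' j = (\<chi> i. if i = j then r' else r'')"

definition approx_reward :: "real \<Rightarrow> real \<Rightarrow> real ^ 'n \<Rightarrow> real" where
  "approx_reward r' r'' b =
     (MAX j\<in>UNIV. b \<bullet> prediction_reward r' r'' j
        - fenchel_conjugate prob_vectors neg_entropy (prediction_reward r' r'' j))"

end

theory Submission
  imports Defs
begin

text \<open>Let \<open>m = r' - r''\<close> and let \<open>t = b\<^sub>j\<close> be the largest entry of \<open>b\<close>. Then
  \<open>\<rho>(b) \<le> ln t\<close> because the entries sum to \<open>1\<close>, and \<open>\<langle>b, r\<^sub>j\<rangle> = r'' + m t\<close>. Up to the conjugate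
  term, which Gibbs' inequality bounds, the gap is at most \<open>ln t - m t - r''\<close>, and
  \<open>ln (m t) \<le> m t - 1\<close> bounds this by \<open>\<epsilon>\<^sub>1 - r''\<close>.\<close>

text \<open>Apply \<open>ln u \<le> u - 1\<close> in each coordinate to the ratio \<open>u\<close>
  of the softmax weight \<open>exp (x $ i) / ?S\<close> to \<open>b $ i\<close>, then average with
  weights \<open>b $ i\<close>.\<close>

lemma gibbs_exp:
  fixes b x :: "real ^ 'n"
  assumes "b \<in> prob_vectors"
  shows "b \<bullet> x - neg_entropy b \<le> ln (\<Sum>i\<in>UNIV. exp (x $ i))"
proof -
  let ?S = "\<Sum>i\<in>UNIV. exp (x $ i)"
  have S: "?S > 0" by (intro sum_pos) auto
  have nn: "\<And>i. b $ i \<ge> 0" and sb: "(\<Sum>i\<in>UNIV. b $ i) = 1"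
    using assms by (auto simp: prob_vectors_def)
  have "b $ i * x $ i - b $ i * ln (b $ i) \<le> b $ i * ln ?S + exp (x $ i) / ?S - b $ i" for i
  \<comment> \<open>The ratio needs \<open>b $ i > 0\<close>; at \<open>b $ i = 0\<close> the claim
    is just \<open>0 \<le> exp (x $ i) / ?S\<close>.\<close>
  proof (cases "b $ i = 0")
    case False
    then have pos: "b $ i > 0" using nn[of i] by simp
    have "x $ i - ln (b $ i) - ln ?S = ln (exp (x $ i) / (b $ i * ?S))"
      using pos S by (simp add: ln_div ln_mult)
    also have "\<dots> \<le> exp (x $ i) / (b $ i * ?S) - 1"
      using pos S by (intro ln_le_minus_one) simp
    finally have "b $ i * (x $ i - ln (b $ i) - ln ?S) \<le> b $ i * (exp (x $ i) / (b $ i * ?S) - 1)"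
      using nn by (rule mult_left_mono)
    also have "\<dots> = exp (x $ i) / ?S - b $ i"
      using pos by (simp add: right_diff_distrib)
    finally show ?thesis by (simp add: algebra_simps)
  qed (use S in simp)
  then have "(\<Sum>i\<in>UNIV. b $ i * x $ i - b $ i * ln (b $ i))
      \<le> (\<Sum>i\<in>UNIV. b $ i * ln ?S + exp (x $ i) / ?S - b $ i)"
    by (rule sum_mono)
  \<comment> \<open>The softmax weights and the entries of \<open>b\<close> both sum to 1, so they
    cancel.\<close>
  also have "\<dots> = ln ?S"
    using S by (simp add: sum.distrib sum_subtractf sb
        flip: sum_distrib_right sum_divide_distrib)
  finally show ?thesis
    by (simp add: inner_vec_def neg_entropy_def shannon_entropy_def sum_subtractf)
qed

text \<open>The conjugate enters \<open>approx_reward\<close> with a minus sign, so an upper bound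
  on it bounds \<open>approx_reward\<close> from below.\<close>

lemma fenchel_conjugate_neg_entropy_le:
  fixes x :: "real ^ 'n"
  shows "fenchel_conjugate prob_vectors neg_entropy x \<le> ln (\<Sum>i\<in>UNIV. exp (x $ i))"
proof -
  \<comment> \<open>The uniform distribution shows that the supremum is over a nonempty set.\<close>
  have "(\<chi> i. 1 / real CARD('n)) \<in> (prob_vectors :: (real ^ 'n) set)"
    by (simp add: prob_vectors_def)
  then show ?thesis
    unfolding fenchel_conjugate_def by (intro cSUP_least gibbs_exp) auto
qed

lemma sum_exp_prediction_reward:
  "(\<Sum>i\<in>UNIV. exp (prediction_reward r' r'' j $ i))
    = exp r' + (real CARD('n) - 1) * exp r''" for j :: "'n::finite"
  by (simp add: prediction_reward_def if_distrib sum.If_cases Compl_eq_Diff_UNIV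
      card_Diff_singleton of_nat_diff)

lemma inner_prediction_reward:
  fixes b :: "real ^ 'n"
  assumes "(\<Sum>i\<in>UNIV. b $ i) = 1"
  shows "b \<bullet> prediction_reward r' r'' j = r'' + (r' - r'') * b $ j"
proof -
  have "b \<bullet> prediction_reward r' r'' j
      = (\<Sum>i\<in>UNIV. b $ i * r'' + (if i = j then (r' - r'') * b $ i else 0))"
    unfolding inner_vec_def prediction_reward_def
    by (intro sum.cong) (auto simp: algebra_simps)
  then show ?thesis
    by (simp add: sum.distrib assms flip: sum_distrib_right)
qed

text \<open>The negative entropy is the \<open>b\<close>-weighted average of the
  \<open>ln (b $ i)\<close>, and those with positive weight are at most \<open>ln t\<close>.\<close>

lemma neg_entropy_le_ln:
  fixes b :: "real ^ 'n"
  assumes "b \<in> prob_vectors" and "\<And>i. b $ i \<le> t"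
  shows "neg_entropy b \<le> ln t"
proof -
  have nn: "\<And>i. b $ i \<ge> 0" and sb: "(\<Sum>i\<in>UNIV. b $ i) = 1"
    using assms by (auto simp: prob_vectors_def)
  have "b $ i * ln (b $ i) \<le> b $ i * ln t" for i
  proof (cases "b $ i = 0")
    case False
    then have "b $ i > 0" using nn[of i] by simp
    then show ?thesis using assms(2)[of i] by simp
  qed simp
  then have "neg_entropy b \<le> (\<Sum>i\<in>UNIV. b $ i * ln t)"
    by (simp add: neg_entropy_def shannon_entropy_def sum_mono)
  then show ?thesis by (simp add: sb flip: sum_distrib_right)
qed

theorem theorem3p3:
  fixes r' r'' :: real and b :: "real ^ 'n"
  assumes "1 \<le> r' - r''" and "r' - r'' \<le> real CARD('n)"
    and "\<forall>i. b $ i \<in> {0..1}" and "(\<Sum>i\<in>UNIV. b $ i) = 1"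
  shows "neg_entropy b - approx_reward r' r'' b
    \<le> max (ln (1 / (r' - r'')) - 1)
          (ln (1 / real CARD('n)) - (r' - r'') / real CARD('n))
      - r'' + ln (exp r' + (real CARD('n) - 1) * exp r'')"
proof -
  let ?m = "r' - r''" and ?L = "ln (exp r' + (real CARD('n) - 1) * exp r'')"
  have b: "b \<in> prob_vectors" using assms by (auto simp: prob_vectors_def)
  have "Max (range (($) b)) \<in> range (($) b)" by (intro Max_in) auto
  then obtain j where "Max (range (($) b)) = b $ j" by blast
  then have j: "b $ i \<le> b $ j" for i
    by (metis Max_ge finite finite_imageI rangeI)
  \<comment> \<open>Positivity lets \<open>ln (?m * b $ j)\<close> split into a sum of logarithms
    below.\<close>
  have pos: "b $ j > 0"
  proof (rule ccontr)
    assume "\<not> b $ j > 0"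
    then have "b $ i \<le> 0" for i using j[of i] by linarith
    then have "(\<Sum>i\<in>UNIV. b $ i) \<le> 0" by (intro sum_nonpos) auto
    then show False using assms(4) by simp
  qed
  have "b \<bullet> prediction_reward r' r'' j
        - fenchel_conjugate prob_vectors neg_entropy (prediction_reward r' r'' j)
      \<le> approx_reward r' r'' b"
    unfolding approx_reward_def by (intro Max_ge) auto
  moreover have "fenchel_conjugate prob_vectors neg_entropy (prediction_reward r' r'' j) \<le> ?L"
    using fenchel_conjugate_neg_entropy_le[of "prediction_reward r' r'' j"]
    by (simp only: sum_exp_prediction_reward)
  ultimately have "r'' + ?m * b $ j - ?L \<le> approx_reward r' r'' b"
    by (simp add: inner_prediction_reward[OF assms(4)])
  moreover have "neg_entropy b \<le> ln (b $ j)"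
    using b j by (rule neg_entropy_le_ln)
  moreover have "ln (b $ j) - ?m * b $ j \<le> ln (1 / ?m) - 1"
    using ln_le_minus_one[of "?m * b $ j"] pos assms(1) by (simp add: ln_mult ln_div)
  \<comment> \<open>The bound reached contains the first argument of \<open>max\<close>, which is at
    most the maximum.\<close>
  ultimately show ?thesis by linarith
qed

end
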